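(* Let $G=(V,E)$ be an arbitrary simple undirected graph on the labelled node set $V=\{v_1,\dots,v_n\}$, and let $\Omega_G$ be the set of all simple undirected graphs on $V$ that have the same degree sequence as $G$ (i.e. $\deg(v_i)$ is the same for every $i$). Consider the Markov chain on $\Omega_G$ started at $G$ in which each step is a global trade, performed as follows: a permutation $\pi$ of $V$ is drawn uniformly at random, and the trades $t_i$ between the nodes $\pi(v_{2i-1})$ and $\pi(v_{2i})$, $i=1,\dots,\lfloor n/2\rfloor$, are applied successively (if $n$ is odd, $\pi(v_n)$ is not traded), each with a permutation $\sigma_i$ chosen uniformly at random as described in the context. Then this Markov chain (the Curveball algorithm with global trades) converges to the uniform distribution on $\Omega_G$.
   Context: For a simple graph with adjacency lists $A$ (so $A_x$ is the set of neighbours of $x$), a (simple undirected) trade $t=(i,j,\sigma)$ between two distinct nodes $i,j$ is defined as follows. Let $A_{i-j}:=A_i\setminus(A_j\cup\{j\})$ and $A_{j-i}:=A_j\setminus(A_i\cup\{i\})$ (the disjoint neighbours), and let $\sigma$ be a permutation of $A_{i-j}\cup A_{j-i}$. The result of the trade is the adjacency structure $B$ with $B_i=(A_i\setminus A_{i-j})\cup\sigma(A_{i-j})$ and $B_j=(A_j\setminus A_{j-i})\cup\sigma(A_{j-i})$; to preserve symmetry, for every $u\in A_i\setminus B_i$ the label $i$ in the adjacency list of $u$ is replaced by $j$, and for every $u\in A_j\setminus B_j$ the label $j$ in the adjacency list of $u$ is replaced by $i$. In the chain, each $\sigma_i$ is drawn uniformly at random among the permutations of the disjoint neighbours of the current graph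 at the moment trade $t_i$ is applied. A global trade $T=(t_1,\dots,t_\ell)$, $\ell=\lfloor n/2\rfloor$, applied to a graph means applying $t_1,\dots,t_\ell$ successively starting from that graph. *)

theory Defs
  imports "HOL-Probability.Probability" "HOL-Combinatorics.Permutations"
begin

text \<open>A graph is given by its adjacency structure: \<open>A x\<close> is the set of neighbours of \<open>x\<close>.\<close>

type_synonym 'a adj = "'a \<Rightarrow> 'a set"

text \<open>Nodes outside \<open>V\<close> have no neighbours, so that two graphs on \<open>V\<close> are equal as functions
  iff they have the same edges.\<close>

definition simple_graph :: "'a set \<Rightarrow> 'a adj \<Rightarrow> bool" where
  "simple_graph V A \<longleftrightarrow>
     (\<forall>x. A x \<subseteq> V) \<and> (\<forall>x. x \<notin> V \<longrightarrow> A x = {}) \<and>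
     (\<forall>x. x \<notin> A x) \<and> (\<forall>x y. y \<in> A x \<longrightarrow> x \<in> A y)"

definition same_degree_graphs :: "'a set \<Rightarrow> 'a adj \<Rightarrow> 'a adj set" where
  "same_degree_graphs V A = {B. simple_graph V B \<and> (\<forall>x\<in>V. card (B x) = card (A x))}"

definition disjoint_nbrs :: "'a adj \<Rightarrow> 'a \<Rightarrow> 'a \<Rightarrow> 'a set" where
  "disjoint_nbrs A i j = A i - (A j \<union> {j})"

definition trade :: "'a \<Rightarrow> 'a \<Rightarrow> ('a \<Rightarrow> 'a) \<Rightarrow> 'a adj \<Rightarrow> 'a adj" where
  "trade i j \<sigma> A =
     (let Bi = (A i - disjoint_nbrs A i j) \<union> \<sigma> ` disjoint_nbrs A i j;
          Bj = (A j - disjoint_nbrs A j i) \<union> \<sigma> ` disjoint_nbrs A j i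
      in (\<lambda>u. if u = i then Bi
              else if u = j then Bj
              else if u \<in> A i - Bi then (A u - {i}) \<union> {j}
              else if u \<in> A j - Bj then (A u - {j}) \<union> {i}
              else A u))"

definition random_trade :: "'a \<Rightarrow> 'a \<Rightarrow> 'a adj \<Rightarrow> 'a adj pmf" where
  "random_trade i j A =
     map_pmf (\<lambda>\<sigma>. trade i j \<sigma> A)
       (pmf_of_set {\<sigma>. \<sigma> permutes (disjoint_nbrs A i j \<union> disjoint_nbrs A j i)})"

text \<open>Each trade is drawn relative to the graph produced by the preceding ones.\<close>

primrec random_trades :: "('a \<times> 'a) list \<Rightarrow> 'a adj \<Rightarrow> 'a adj pmf" where
  "random_trades [] A = return_pmf A"
| "random_trades (t # ts) A = bind_pmf (random_trade (fst t) (snd t) A) (random_trades ts)"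

text \<open>The nodes are \<open>v 1, \<dots>, v n\<close>.\<close>

definition global_trade :: "nat \<Rightarrow> (nat \<Rightarrow> 'a) \<Rightarrow> 'a adj \<Rightarrow> 'a adj pmf" where
  "global_trade n v A =
     bind_pmf (pmf_of_set {\<pi>. \<pi> permutes (v ` {1..n})})
       (\<lambda>\<pi>. random_trades (map (\<lambda>i. (\<pi> (v (2 * i - 1)), \<pi> (v (2 * i)))) [1..<n div 2 + 1]) A)"

text \<open>The law at time \<open>t\<close> of the Markov chain with transition kernel \<open>K\<close> started at \<open>x\<close>.\<close>

primrec chain_law :: "('s \<Rightarrow> 's pmf) \<Rightarrow> 's \<Rightarrow> nat \<Rightarrow> 's pmf" where
  "chain_law K x 0 = return_pmf x"
| "chain_law K x (Suc t) = bind_pmf (chain_law K x t) K"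

text \<open>The set of graphs with prescribed degrees is finite and nonempty, so the uniform
  distribution on it is the intended one, and the chain never leaves it.\<close>

lemma finite_same_degree_graphs:
  assumes "finite V"
  shows "finite (same_degree_graphs V A)"
proof (rule finite_subset)
  show "same_degree_graphs V A \<subseteq> {f. (\<forall>x. (x \<in> V \<longrightarrow> f x \<in> Pow V) \<and> (x \<notin> V \<longrightarrow> f x = {}))}"
    by (auto simp: same_degree_graphs_def simple_graph_def)
  show "finite {f. (\<forall>x. (x \<in> V \<longrightarrow> f x \<in> Pow V) \<and> (x \<notin> V \<longrightarrow> f x = {}))}"
    by (rule finite_set_of_finite_funs) (use assms in auto)
qed

lemma self_in_same_degree_graphs:
  "simple_graph V A \<Longrightarrow> A \<in> same_degree_graphs V A"
  by (simp add: same_degree_graphs_def)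

lemma trade_in_same_degree_graphs:
  assumes V: "finite V" "i \<in> V" "j \<in> V" "i \<noteq> j"
    and B: "B \<in> same_degree_graphs V A"
    and \<sigma>: "\<sigma> permutes (disjoint_nbrs B i j \<union> disjoint_nbrs B j i)"
  shows "trade i j \<sigma> B \<in> same_degree_graphs V A"
proof -
  define P where "P = disjoint_nbrs B i j"
  define Q where "Q = disjoint_nbrs B j i"
  define C where "C = trade i j \<sigma> B"
  have sub: "\<And>x. B x \<subseteq> V" and out: "\<And>x. x \<notin> V \<Longrightarrow> B x = {}" and irr: "\<And>x. x \<notin> B x"
    and sym: "\<And>x y. y \<in> B x \<Longrightarrow> x \<in> B y" and deg: "\<And>x. x \<in> V \<Longrightarrow> card (B x) = card (A x)"
    using B by (auto simp: same_degree_graphs_def simple_graph_def)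
  have fin: "finite (B x)" for x using sub V(1) finite_subset by blast
  have P: "P = B i - B j - {j}" and Q: "Q = B j - B i - {i}"
    by (auto simp: P_def Q_def disjoint_nbrs_def)
  have finPQ: "finite P" "finite Q" using fin by (auto simp: P Q)
  have PQ: "P \<inter> Q = {}" by (auto simp: P Q)
  have perm: "\<sigma> permutes (P \<union> Q)" using \<sigma> by (simp add: P_def Q_def)
  have inj: "inj \<sigma>" using perm by (rule permutes_inj)
  have im: "\<sigma> ` P \<union> \<sigma> ` Q = P \<union> Q" using permutes_image[OF perm] by (simp add: image_Un)
  have dis: "\<sigma> ` P \<inter> \<sigma> ` Q = {}" using inj PQ by (metis image_Int image_empty)
  have Ci: "C i = (B i - P) \<union> \<sigma> ` P" and Cj: "C j = (B j - Q) \<union> \<sigma> ` Q"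
    using V(4) by (simp_all add: C_def trade_def Let_def P_def Q_def)
  have ki: "u \<in> B i - C i \<longleftrightarrow> u \<in> P \<and> u \<in> \<sigma> ` Q" for u
    unfolding Ci using im dis P by blast
  have kj: "u \<in> B j - C j \<longleftrightarrow> u \<in> Q \<and> u \<in> \<sigma> ` P" for u
    unfolding Cj using im dis Q by blast
  have Cu: "C u = (if u \<in> P \<and> u \<in> \<sigma> ` Q then (B u - {i}) \<union> {j}
                   else if u \<in> Q \<and> u \<in> \<sigma> ` P then (B u - {j}) \<union> {i} else B u)"
    if "u \<noteq> i" "u \<noteq> j" for u
  proof -
    have "C u = (if u \<in> B i - C i then (B u - {i}) \<union> {j}
                 else if u \<in> B j - C j then (B u - {j}) \<union> {i} else B u)"
      unfolding Ci Cj using that by (simp add: C_def trade_def Let_def P_def Q_def)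
    then show ?thesis by (simp only: ki kj)
  qed
  have nP: "i \<notin> P" "j \<notin> P" "i \<notin> Q" "j \<notin> Q" using irr by (auto simp: P Q)
  have memi: "u \<in> C i \<longleftrightarrow> i \<in> C u" if "u \<noteq> i" "u \<noteq> j" for u
  proof -
    have s: "i \<in> B u \<longleftrightarrow> u \<in> B i" "j \<in> B u \<longleftrightarrow> u \<in> B j" using sym by blast+
    show ?thesis unfolding Cu[OF that] Ci using s im dis PQ P Q V(4) that by (auto split: if_splits)
  qed
  have memj: "u \<in> C j \<longleftrightarrow> j \<in> C u" if "u \<noteq> i" "u \<noteq> j" for u
  proof -
    have s: "i \<in> B u \<longleftrightarrow> u \<in> B i" "j \<in> B u \<longleftrightarrow> u \<in> B j" using sym by blast+
    show ?thesis unfolding Cu[OF that] Cj using s im dis PQ P Q V(4) that by (auto split: if_splits)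
  qed
  have nS: "i \<notin> \<sigma> ` P" "j \<notin> \<sigma> ` P" "i \<notin> \<sigma> ` Q" "j \<notin> \<sigma> ` Q" using im nP by blast+
  have ij: "j \<in> C i \<longleftrightarrow> i \<in> C j" unfolding Ci Cj using nS nP sym by blast
  have other: "w \<in> C u \<longleftrightarrow> w \<in> B u" if "u \<noteq> i" "u \<noteq> j" "w \<noteq> i" "w \<noteq> j" for u w
    using that by (simp add: Cu)
  have symC: "y \<in> C x \<Longrightarrow> x \<in> C y" for x y
    using memi memj ij other sym by metis
  have irrC: "x \<notin> C x" for x
  proof -
    consider "x = i" | "x = j" | "x \<noteq> i" "x \<noteq> j" by blast
    then show ?thesis
      by cases (use irr nS other in \<open>auto simp: Ci Cj\<close>)
  qed
  have PV: "P \<subseteq> V" "Q \<subseteq> V" using sub by (auto simp: P Q)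
  have SV: "\<sigma> ` P \<subseteq> V" "\<sigma> ` Q \<subseteq> V" using im PV by blast+
  have subC: "C x \<subseteq> V" for x
  proof -
    consider "x = i" | "x = j" | "x \<noteq> i" "x \<noteq> j" by blast
    then show ?thesis
      by cases (use sub SV V in \<open>auto simp: Ci Cj Cu split: if_splits\<close>)
  qed
  have outC: "C x = {}" if "x \<notin> V" for x
    using subC symC that by (metis equals0I subsetD)
  have graph: "simple_graph V C"
    using subC outC irrC symC by (auto simp: simple_graph_def)
  have cardS: "card (\<sigma> ` P) = card P" "card (\<sigma> ` Q) = card Q"
    using inj by (simp_all add: card_image inj_on_subset)
  have degC: "card (C x) = card (B x)" for x
  proof -
    consider "x = i" | "x = j" | "x \<noteq> i" "x \<noteq> j" by blast
    then show ?thesis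
    proof cases
      case 1
      have "(B i - P) \<inter> \<sigma> ` P = {}" using im PQ P Q by blast
      then have "card (C i) = card (B i - P) + card P"
        unfolding Ci using fin finPQ cardS by (subst card_Un_disjoint) auto
      also have "\<dots> = card (B i)"
        using fin[of i] P by (metis card_Diff_subset card_mono finPQ(1) Diff_subset le_add_diff_inverse2 subset_trans)
      finally show ?thesis using 1 by simp
    next
      case 2
      have "(B j - Q) \<inter> \<sigma> ` Q = {}" using im PQ P Q by blast
      then have "card (C j) = card (B j - Q) + card Q"
        unfolding Cj using fin finPQ cardS by (subst card_Un_disjoint) auto
      also have "\<dots> = card (B j)"
        using fin[of j] Q by (metis card_Diff_subset card_mono finPQ(2) Diff_subset le_add_diff_inverse2 subset_trans)
      finally show ?thesis using 2 by simp
    next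
      case 3
      have s: "i \<in> B x \<longleftrightarrow> x \<in> B i" "j \<in> B x \<longleftrightarrow> x \<in> B j" using sym by blast+
      have a: "card (B x - {a} \<union> {b}) = card (B x)" if "a \<in> B x" "b \<notin> B x" for a b
      proof -
        have "card (B x - {a} \<union> {b}) = Suc (card (B x - {a}))"
          using that(2) fin[of x] by simp
        also have "\<dots> = card (B x)" using card.remove[OF fin[of x] that(1)] by linarith
        finally show ?thesis .
      qed
      have "x \<in> P \<Longrightarrow> i \<in> B x \<and> j \<notin> B x" "x \<in> Q \<Longrightarrow> j \<in> B x \<and> i \<notin> B x"
        using s by (auto simp: P Q)
      then show ?thesis unfolding Cu[OF 3] using a[of i j] a[of j i] by simp
    qed
  qed
  show ?thesis
    using graph degC deg by (simp add: same_degree_graphs_def flip: C_def)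
qed

lemma random_trade_in_same_degree_graphs:
  assumes "finite V" "i \<in> V" "j \<in> V" "i \<noteq> j" "B \<in> same_degree_graphs V A"
  shows "set_pmf (random_trade i j B) \<subseteq> same_degree_graphs V A"
proof -
  let ?S = "disjoint_nbrs B i j \<union> disjoint_nbrs B j i"
  have "?S \<subseteq> V"
    using assms(5) by (auto simp: disjoint_nbrs_def same_degree_graphs_def simple_graph_def)
  then have "finite ?S" using assms(1) finite_subset by blast
  then have "finite {\<sigma>. \<sigma> permutes ?S}" by (rule finite_permutations)
  moreover have "{\<sigma>. \<sigma> permutes ?S} \<noteq> {}" using permutes_id by blast
  ultimately show ?thesis
    using trade_in_same_degree_graphs[OF assms] by (auto simp: random_trade_def)
qed

lemma random_trades_in_same_degree_graphs:
  assumes "finite V" "\<forall>t\<in>set ts. fst t \<in> V \<and> snd t \<in> V \<and> fst t \<noteq> snd t"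
    and "B \<in> same_degree_graphs V A"
  shows "set_pmf (random_trades ts B) \<subseteq> same_degree_graphs V A"
  using assms(2,3)
proof (induction ts arbitrary: B)
  case (Cons t ts)
  have "set_pmf (random_trade (fst t) (snd t) B) \<subseteq> same_degree_graphs V A"
    using Cons.prems assms(1) by (intro random_trade_in_same_degree_graphs) auto
  then show ?case using Cons.IH Cons.prems by auto
qed simp

lemma global_trade_in_same_degree_graphs:
  assumes "inj_on v {1..n}" "B \<in> same_degree_graphs (v ` {1..n}) A"
  shows "set_pmf (global_trade n v B) \<subseteq> same_degree_graphs (v ` {1..n}) A"
proof -
  let ?V = "v ` {1..n}"
  have fin: "finite {\<pi>. \<pi> permutes ?V}" by (simp add: finite_permutations)
  have ne: "{\<pi>. \<pi> permutes ?V} \<noteq> {}" using permutes_id by blast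
  have "set_pmf (random_trades (map (\<lambda>i. (\<pi> (v (2 * i - 1)), \<pi> (v (2 * i)))) [1..<n div 2 + 1]) B)
      \<subseteq> same_degree_graphs ?V A" if pi: "\<pi> permutes ?V" for \<pi>
  proof (rule random_trades_in_same_degree_graphs[OF _ _ assms(2)])
    have "\<pi> (v (2 * i - 1)) \<in> ?V \<and> \<pi> (v (2 * i)) \<in> ?V \<and> \<pi> (v (2 * i - 1)) \<noteq> \<pi> (v (2 * i))"
      if i: "1 \<le> i" "i \<le> n div 2" for i
    proof -
      have r: "2 * i - 1 \<in> {1..n}" "2 * i \<in> {1..n}" using i by auto
      moreover have "v (2 * i - 1) \<noteq> v (2 * i)" using inj_onD[OF assms(1) _ r] i by auto
      ultimately show ?thesis
        using permutes_in_image[OF pi] permutes_inj[OF pi] by (auto dest: injD)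
    qed
    then show "\<forall>t\<in>set (map (\<lambda>i. (\<pi> (v (2 * i - 1)), \<pi> (v (2 * i)))) [1..<n div 2 + 1]).
        fst t \<in> ?V \<and> snd t \<in> ?V \<and> fst t \<noteq> snd t"
      by auto
  qed simp
  then show ?thesis
    unfolding global_trade_def set_bind_pmf set_pmf_of_set[OF ne fin] by blast
qed

end

theory Submission
  imports Defs
begin

text \<open>A single trade is a symmetric kernel, because inverting \<open>\<sigma>\<close> undoes it; so it preserves
  the uniform distribution, and so does every mixture of compositions of trades. Every trade may
  act as the identity, which makes the global chain aperiodic and lets it perform any single
  trade. Trades connect all graphs with given degrees: fixing the neighbourhoods node by node, two
  graphs that disagree at \<open>v\<close> can be brought closer at \<open>v\<close> by a trade in one of them that
  exchanges a neighbour of \<open>v\<close> for a non-neighbour of at least the same residual degree. Since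
  powers of the kernel are eventually positive on the finite state space, the \<open>L\<^sup>1\<close>-distance to
  the stationary distribution decays by Doeblin's argument.\<close>

section \<open>Convergence of finite Markov chains\<close>

text \<open>The Chapman-Kolmogorov equation: it makes the law at a later time the image of an
  earlier law under a multi-step kernel, the form in which the contraction estimate applies.\<close>

lemma chain_law_add:
  "chain_law K x (s + t) = bind_pmf (chain_law K x s) (\<lambda>y. chain_law K y t)"
proof (induction t)
  case 0
  show ?case by (simp add: bind_return_pmf')
next
  case (Suc t)
  then show ?case by (simp add: bind_assoc_pmf)
qed

lemma chain_law_support:
  assumes "\<And>x. x \<in> S \<Longrightarrow> set_pmf (K x) \<subseteq> S" and "x \<in> S"
  shows "set_pmf (chain_law K x t) \<subseteq> S"
proof (induction t)
  case 0
  then show ?case using assms(2) by simp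
next
  case (Suc t)
  then show ?case by (auto dest: subsetD[OF assms(1)])
qed

lemma bind_chain_law_stationary:
  assumes "bind_pmf u K = u"
  shows "bind_pmf u (\<lambda>x. chain_law K x t) = u"
proof (induction t)
  case 0
  show ?case by (simp add: bind_return_pmf')
next
  case (Suc t)
  then show ?case using assms by (simp flip: bind_assoc_pmf)
qed

lemma pmf_bind_finite:
  assumes "finite S" "set_pmf p \<subseteq> S"
  shows "pmf (bind_pmf p L) y = (\<Sum>x\<in>S. pmf p x * pmf (L x) y)"
  unfolding pmf_bind by (subst integral_measure_pmf[OF assms(1)]) (use assms in auto)

text \<open>For laws supported in \<open>S\<close> this is twice the total variation
  distance.\<close>

definition l1_dist :: "'s set \<Rightarrow> 's pmf \<Rightarrow> 's pmf \<Rightarrow> real" where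
  "l1_dist S p q = (\<Sum>y\<in>S. \<bar>pmf p y - pmf q y\<bar>)"

text \<open>Doeblin's estimate: since \<open>p\<close> and \<open>q\<close> have equal mass,
  \<open>e\<close> may be subtracted from every kernel entry without changing the difference of the
  images. The reduced entries are nonnegative and each row sums to \<open>1 - card S * e\<close>.
  The case \<open>e = 0\<close> says that no kernel increases the distance.\<close>

lemma l1_dist_bind_le:
  fixes e :: real
  assumes S: "finite S" "set_pmf p \<subseteq> S" "set_pmf q \<subseteq> S"
    and L: "\<And>x. x \<in> S \<Longrightarrow> set_pmf (L x) \<subseteq> S"
    and e: "\<And>x y. x \<in> S \<Longrightarrow> y \<in> S \<Longrightarrow> e \<le> pmf (L x) y"
  shows "l1_dist S (bind_pmf p L) (bind_pmf q L) \<le> (1 - card S * e) * l1_dist S p q"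
proof -
  have one: "(\<Sum>x\<in>S. pmf r x) = 1" if "set_pmf r \<subseteq> S" for r
    using sum_pmf_eq_1[OF S(1) that] .
  have diff: "pmf (bind_pmf p L) y - pmf (bind_pmf q L) y
      = (\<Sum>x\<in>S. (pmf p x - pmf q x) * (pmf (L x) y - e))" for y
  proof -
    \<comment> \<open>The signed measure \<open>p - q\<close> has total mass zero, so the constant
      \<open>e\<close> contributes nothing.\<close>
    have "(\<Sum>x\<in>S. (pmf p x - pmf q x) * e) = 0"
      using one[OF S(2)] one[OF S(3)] by (simp add: sum_subtractf flip: sum_distrib_right)
    then show ?thesis
      by (simp add: pmf_bind_finite[OF S(1,2)] pmf_bind_finite[OF S(1,3)] right_diff_distrib
          left_diff_distrib sum_subtractf)
  qed
  have "l1_dist S (bind_pmf p L) (bind_pmf q L)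
      \<le> (\<Sum>y\<in>S. \<Sum>x\<in>S. \<bar>pmf p x - pmf q x\<bar> * (pmf (L x) y - e))"
    unfolding l1_dist_def diff
  proof (rule sum_mono)
    fix y assume y: "y \<in> S"
    have "\<bar>\<Sum>x\<in>S. (pmf p x - pmf q x) * (pmf (L x) y - e)\<bar>
        \<le> (\<Sum>x\<in>S. \<bar>(pmf p x - pmf q x) * (pmf (L x) y - e)\<bar>)"
      by (rule sum_abs)
    also have "\<dots> = (\<Sum>x\<in>S. \<bar>pmf p x - pmf q x\<bar> * (pmf (L x) y - e))"
      using e y by (intro sum.cong) (auto simp: abs_mult)
    finally show "\<bar>\<Sum>x\<in>S. (pmf p x - pmf q x) * (pmf (L x) y - e)\<bar>
        \<le> (\<Sum>x\<in>S. \<bar>pmf p x - pmf q x\<bar> * (pmf (L x) y - e))" .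
  qed
  also have "\<dots> = (\<Sum>x\<in>S. \<bar>pmf p x - pmf q x\<bar> * (\<Sum>y\<in>S. pmf (L x) y - e))"
    by (subst sum.swap) (simp add: sum_distrib_left)
  also have "\<dots> = (\<Sum>x\<in>S. \<bar>pmf p x - pmf q x\<bar> * (1 - card S * e))"
    using one[OF L] by (intro sum.cong) (auto simp: sum_subtractf)
  also have "\<dots> = (1 - card S * e) * l1_dist S p q"
    by (simp add: l1_dist_def sum_distrib_left mult.commute)
  finally show ?thesis .
qed

text \<open>Because of the loops, a state reachable in \<open>s\<close> steps is reachable in any
  larger number of steps. Hence the maximum of finitely many travel times serves all pairs at
  once.\<close>

lemma chain_law_reaches_all:
  assumes S: "finite S"
    and closed: "\<And>x. x \<in> S \<Longrightarrow> set_pmf (K x) \<subseteq> S"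
    and loop: "\<And>x. x \<in> S \<Longrightarrow> x \<in> set_pmf (K x)"
    and irred: "\<And>x y. x \<in> S \<Longrightarrow> y \<in> S \<Longrightarrow> (x, y) \<in> {(a, b). a \<in> S \<and> b \<in> set_pmf (K a)}\<^sup>*"
  obtains N where "\<And>x y. x \<in> S \<Longrightarrow> y \<in> S \<Longrightarrow> y \<in> set_pmf (chain_law K x N)"
proof -
  have "\<exists>t. y \<in> set_pmf (chain_law K x t)"
    if "x \<in> S" "(x, y) \<in> {(a, b). a \<in> S \<and> b \<in> set_pmf (K a)}\<^sup>*" for x y
    using that(2)
  proof (induction rule: rtrancl_induct)
    case base
    have "x \<in> set_pmf (chain_law K x 0)" by simp
    then show ?case by blast
  next
    case (step y z)
    then obtain t where "y \<in> set_pmf (chain_law K x t)" by blast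
    with step have "z \<in> set_pmf (chain_law K x (Suc t))" by auto
    then show ?case by blast
  qed
  then have "\<forall>x y. \<exists>t. x \<in> S \<longrightarrow> y \<in> S \<longrightarrow> y \<in> set_pmf (chain_law K x t)"
    using irred by blast
  then obtain T where T: "\<And>x y. x \<in> S \<Longrightarrow> y \<in> S \<Longrightarrow> y \<in> set_pmf (chain_law K x (T x y))"
    by metis
  have stay: "y \<in> set_pmf (chain_law K x (s + t))" if "y \<in> S" "y \<in> set_pmf (chain_law K x s)" for x y s t
    using that loop by (induction t) auto
  define N where "N = Max ((\<lambda>(x, y). T x y) ` (S \<times> S))"
  have "y \<in> set_pmf (chain_law K x N)" if xy: "x \<in> S" "y \<in> S" for x y
  proof -
    have "T x y \<le> N" unfolding N_def using S xy by (intro Max_ge) auto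
    then show ?thesis using stay[OF xy(2) T[OF xy], of "N - T x y"] by simp
  qed
  then show ?thesis using that by blast
qed

theorem chain_law_converges:
  assumes S: "finite S"
    and closed: "\<And>x. x \<in> S \<Longrightarrow> set_pmf (K x) \<subseteq> S"
    and loop: "\<And>x. x \<in> S \<Longrightarrow> x \<in> set_pmf (K x)"
    and irred: "\<And>x y. x \<in> S \<Longrightarrow> y \<in> S \<Longrightarrow> (x, y) \<in> {(a, b). a \<in> S \<and> b \<in> set_pmf (K a)}\<^sup>*"
    and u: "set_pmf u \<subseteq> S" "bind_pmf u K = u"
    and x: "x \<in> S"
  shows "(\<lambda>t. pmf (chain_law K x t) y) \<longlonglongrightarrow> pmf u y"
proof -
  obtain N where N: "\<And>x y. x \<in> S \<Longrightarrow> y \<in> S \<Longrightarrow> y \<in> set_pmf (chain_law K x N)"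
    using chain_law_reaches_all[OF S closed loop irred] by blast
  \<comment> \<open>The Doeblin constant: the smallest \<open>N\<close>-step transition probability,
    positive because all pairs communicate at the same time \<open>N\<close>.\<close>
  define e where "e = Min ((\<lambda>(x, y). pmf (chain_law K x N) y) ` (S \<times> S))"
  have e: "e \<le> pmf (chain_law K x N) y" if "x \<in> S" "y \<in> S" for x y
    unfolding e_def using S that by (intro Min_le) auto
  have e0: "e > 0"
    unfolding e_def using S x N by (subst Min_gr_iff) (auto simp: pmf_positive)
  have supp: "set_pmf (chain_law K z t) \<subseteq> S" if "z \<in> S" for z t
    using chain_law_support[of S K z t] closed that by blast
  define d where "d t = l1_dist S (chain_law K x t) u" for t
  have d0: "d t \<ge> 0" for t by (simp add: d_def l1_dist_def sum_nonneg)
  \<comment> \<open>Stated for a general lower bound \<open>r\<close> because it is used twice: with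
    \<open>r = e\<close> over \<open>N\<close> steps for the geometric decay, and with
    \<open>r = 0\<close> over any number of steps for monotonicity.\<close>
  have contract: "d (s + t) \<le> (1 - card S * r) * d s"
    if "\<And>x y. x \<in> S \<Longrightarrow> y \<in> S \<Longrightarrow> r \<le> pmf (chain_law K x t) y" for r :: real and s t
  proof -
    have "l1_dist S (bind_pmf (chain_law K x s) (\<lambda>y. chain_law K y t))
        (bind_pmf u (\<lambda>y. chain_law K y t)) \<le> (1 - card S * r) * l1_dist S (chain_law K x s) u"
      by (rule l1_dist_bind_le[OF S supp[OF x] u(1) supp that])
    then show ?thesis
      by (simp add: d_def chain_law_add bind_chain_law_stationary[OF u(2)])
  qed
  define c where "c = 1 - card S * e"
  have "d (s + N) \<le> c * d s" for s
    unfolding c_def by (rule contract) (rule e)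
  moreover have c1: "c < 1"
  proof -
    have "card S > 0" using S x by (auto simp: card_gt_0_iff)
    then show ?thesis using e0 by (simp add: c_def)
  qed
  \<comment> \<open>A row of the \<open>N\<close>-step kernel has mass one and entries at least
    \<open>e\<close>. Nonnegativity of \<open>c\<close> is what allows the bound to be
    iterated.\<close>
  moreover have c0: "c \<ge> 0"
  proof -
    have "card S * e = (\<Sum>y\<in>S. e)" by simp
    also have "\<dots> \<le> (\<Sum>y\<in>S. pmf (chain_law K x N) y)" using e x by (intro sum_mono) auto
    also have "\<dots> = 1" by (rule sum_pmf_eq_1[OF S supp[OF x]])
    finally show ?thesis by (simp add: c_def)
  qed
  ultimately have pow: "d (k * N) \<le> c ^ k * d 0" for k
  proof (induction k)
    case (Suc k)
    have "d (Suc k * N) \<le> c * d (k * N)"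
      using Suc.prems(1)[of "k * N"] by (simp add: add.commute)
    also have "\<dots> \<le> c * (c ^ k * d 0)"
      using Suc by (intro mult_left_mono) auto
    finally show ?case by (simp add: mult.assoc)
  qed simp
  \<comment> \<open>This extends the decay from multiples of \<open>N\<close> to all times.\<close>
  have dec: "d (s + t) \<le> d s" for s t
    using contract[of 0 t s] by simp
  have "d \<longlonglongrightarrow> 0"
  proof (rule LIMSEQ_I)
    fix r :: real assume r: "r > 0"
    have "(\<lambda>k. c ^ k * d 0) \<longlonglongrightarrow> 0"
      using LIMSEQ_realpow_zero[OF c0 c1] tendsto_mult_left_zero by blast
    then obtain k where k: "norm (c ^ k * d 0 - 0) < r"
      using LIMSEQ_D[OF _ r] by blast
    have "norm (d t - 0) < r" if "t \<ge> k * N" for t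
      using dec[of "k * N" "t - k * N"] pow[of k] k d0[of t] that by auto
    then show "\<exists>no. \<forall>t\<ge>no. norm (d t - 0) < r" by blast
  qed
  show ?thesis
  proof (cases "y \<in> S")
    case True
    have "\<bar>pmf (chain_law K x t) y - pmf u y\<bar> \<le> d t" for t
      unfolding d_def l1_dist_def
      using member_le_sum[OF True, of "\<lambda>y. \<bar>pmf (chain_law K x t) y - pmf u y\<bar>"] S by simp
    then have "\<forall>\<^sub>F t in sequentially. norm (pmf (chain_law K x t) y - pmf u y) \<le> d t"
      by simp
    then show ?thesis
      using \<open>d \<longlonglongrightarrow> 0\<close> by (rule LIM_zero_cancel[OF Lim_null_comparison])
  next
    case False
    then have "pmf (chain_law K x t) y = 0" "pmf u y = 0" for t
      using supp[OF x] u(1) unfolding pmf_eq_0_set_pmf by blast+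
    then show ?thesis by simp
  qed
qed

section \<open>Symmetry of a single trade\<close>

text \<open>By symmetry, the lists of \<open>i\<close> and \<open>j\<close> decide where the labels
  \<open>i\<close> and \<open>j\<close> occur in all other lists. The relabelling clauses of
  \<open>trade\<close> therefore need not be unfolded when graphs are compared.\<close>

lemma simple_graph_eqI:
  assumes "simple_graph V A" "simple_graph V B"
    and ij: "A i = B i" "A j = B j"
    and other: "\<And>u. u \<noteq> i \<Longrightarrow> u \<noteq> j \<Longrightarrow> A u - {i, j} = B u - {i, j}"
  shows "A = B"
proof
  fix u
  have sA: "y \<in> A x \<longleftrightarrow> x \<in> A y" and sB: "y \<in> B x \<longleftrightarrow> x \<in> B y" for x y
    using assms(1,2) by (auto simp: simple_graph_def)
  show "A u = B u"
  proof (cases "u = i \<or> u = j")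
    case False
    show ?thesis
    proof (rule set_eqI)
      fix w
      show "w \<in> A u \<longleftrightarrow> w \<in> B u"
        using False ij sA[of w u] sB[of w u] other[of u] by blast
    qed
  qed (use ij in auto)
qed

lemma disjoint_nbrs_subset:
  assumes "simple_graph V A"
  shows "disjoint_nbrs A i j \<subseteq> V"
  using assms by (auto simp: simple_graph_def disjoint_nbrs_def)

lemma trade_simple_graph:
  assumes "finite V" "i \<in> V" "j \<in> V" "i \<noteq> j" "simple_graph V B"
    and "\<sigma> permutes (disjoint_nbrs B i j \<union> disjoint_nbrs B j i)"
  shows "simple_graph V (trade i j \<sigma> B)"
  using trade_in_same_degree_graphs[OF assms(1-4) self_in_same_degree_graphs assms(6)] assms(5)
  by (simp add: same_degree_graphs_def)

lemma trade_first: "trade i j \<sigma> B i = (B i - disjoint_nbrs B i j) \<union> \<sigma> ` disjoint_nbrs B i j"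
  by (simp add: trade_def Let_def)

lemma trade_second:
  "i \<noteq> j \<Longrightarrow> trade i j \<sigma> B j = (B j - disjoint_nbrs B j i) \<union> \<sigma> ` disjoint_nbrs B j i"
  by (simp add: trade_def Let_def)

lemma trade_other:
  "u \<noteq> i \<Longrightarrow> u \<noteq> j \<Longrightarrow> trade i j \<sigma> B u - {i, j} = B u - {i, j}"
  by (auto simp: trade_def Let_def)

text \<open>A trade keeps the common neighbours and a possible edge between \<open>i\<close> and
  \<open>j\<close>, while \<sigma> only redistributes the disjoint neighbours among
  themselves.\<close>

lemma disjoint_nbrs_trade:
  assumes B: "simple_graph V B" and "i \<noteq> j"
    and \<sigma>: "\<sigma> permutes (disjoint_nbrs B i j \<union> disjoint_nbrs B j i)"
  shows "disjoint_nbrs (trade i j \<sigma> B) i j = \<sigma> ` disjoint_nbrs B i j"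
    and "disjoint_nbrs (trade i j \<sigma> B) j i = \<sigma> ` disjoint_nbrs B j i"
proof -
  define P where "P = disjoint_nbrs B i j"
  define Q where "Q = disjoint_nbrs B j i"
  have P: "P = B i - B j - {j}" and Q: "Q = B j - B i - {i}"
    by (auto simp: P_def Q_def disjoint_nbrs_def)
  have irr: "\<And>x. x \<notin> B x" using B by (auto simp: simple_graph_def)
  have im: "\<sigma> ` P \<union> \<sigma> ` Q = P \<union> Q"
    using permutes_image[OF \<sigma>] by (simp add: image_Un P_def Q_def)
  have "P \<inter> Q = {}" by (auto simp: P Q)
  then have dis: "\<sigma> ` P \<inter> \<sigma> ` Q = {}"
    using permutes_inj[OF \<sigma>] by (metis image_Int image_empty)
  have nS: "i \<notin> \<sigma> ` P" "j \<notin> \<sigma> ` P" "i \<notin> \<sigma> ` Q" "j \<notin> \<sigma> ` Q"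
    using im irr P Q by blast+
  have C: "trade i j \<sigma> B i = (B i - P) \<union> \<sigma> ` P" "trade i j \<sigma> B j = (B j - Q) \<union> \<sigma> ` Q"
    unfolding P_def Q_def by (rule trade_first, rule trade_second[OF \<open>i \<noteq> j\<close>])
  have PQ: "\<sigma> ` P \<inter> (B j - Q) = {}" "\<sigma> ` Q \<inter> (B i - P) = {}"
    using im P Q by blast+
  show "disjoint_nbrs (trade i j \<sigma> B) i j = \<sigma> ` disjoint_nbrs B i j"
    unfolding disjoint_nbrs_def[of "trade i j \<sigma> B"] C P_def[symmetric]
    using nS PQ dis P Q by blast
  show "disjoint_nbrs (trade i j \<sigma> B) j i = \<sigma> ` disjoint_nbrs B j i"
    unfolding disjoint_nbrs_def[of "trade i j \<sigma> B"] C Q_def[symmetric]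
    using nS PQ dis P Q by blast
qed

text \<open>Hence \<open>inv \<sigma>\<close> is an admissible permutation for the graph after the
  trade.\<close>

lemma disjoint_nbrs_trade_Un:
  assumes "simple_graph V B" and "i \<noteq> j"
    and "\<sigma> permutes (disjoint_nbrs B i j \<union> disjoint_nbrs B j i)"
  shows "disjoint_nbrs (trade i j \<sigma> B) i j \<union> disjoint_nbrs (trade i j \<sigma> B) j i
    = disjoint_nbrs B i j \<union> disjoint_nbrs B j i"
  using permutes_image[OF assms(3)] by (simp add: disjoint_nbrs_trade[OF assms] image_Un)

lemma trade_inv:
  assumes V: "finite V" "i \<in> V" "j \<in> V" "i \<noteq> j" and B: "simple_graph V B"
    and \<sigma>: "\<sigma> permutes (disjoint_nbrs B i j \<union> disjoint_nbrs B j i)"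
  shows "trade i j (inv \<sigma>) (trade i j \<sigma> B) = B"
proof (rule simple_graph_eqI[of V _ _ i j])
  let ?P = "disjoint_nbrs B i j" and ?Q = "disjoint_nbrs B j i" and ?C = "trade i j \<sigma> B"
  note dn = disjoint_nbrs_trade[OF B V(4) \<sigma>] disjoint_nbrs_trade_Un[OF B V(4) \<sigma>]
  have im: "\<sigma> ` ?P \<union> \<sigma> ` ?Q = ?P \<union> ?Q"
    using permutes_image[OF \<sigma>] by (simp add: image_Un)
  have inv: "inv \<sigma> ` \<sigma> ` X = X" for X
    by (simp add: image_inv_f_f permutes_inj[OF \<sigma>])
  show "simple_graph V (trade i j (inv \<sigma>) ?C)"
    by (rule trade_simple_graph[OF V trade_simple_graph[OF V B \<sigma>]])
      (simp only: dn(3) permutes_inv[OF \<sigma>])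
  \<comment> \<open>The retained neighbours avoid the set permuted by \<sigma>, so removing the
    traded images recovers exactly the retained part.\<close>
  have "(B i - ?P) \<inter> (?P \<union> ?Q) = {}" "(B j - ?Q) \<inter> (?P \<union> ?Q) = {}"
    by (auto simp: disjoint_nbrs_def)
  then have "(B i - ?P) \<inter> \<sigma> ` ?P = {}" "(B j - ?Q) \<inter> \<sigma> ` ?Q = {}"
    using im by blast+
  then have C: "?C i - \<sigma> ` ?P = B i - ?P" "?C j - \<sigma> ` ?Q = B j - ?Q"
    unfolding trade_first trade_second[OF V(4)] by blast+
  have sub: "?P \<subseteq> B i" "?Q \<subseteq> B j" by (auto simp: disjoint_nbrs_def)
  show "trade i j (inv \<sigma>) ?C i = B i"
    using C sub unfolding trade_first[of i j "inv \<sigma>"] dn inv by blast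
  show "trade i j (inv \<sigma>) ?C j = B j"
    using C sub unfolding trade_second[OF V(4), of "inv \<sigma>"] dn inv by blast
  show "trade i j (inv \<sigma>) ?C u - {i, j} = B u - {i, j}" if "u \<noteq> i" "u \<noteq> j" for u
    using that by (simp add: trade_other)
qed (fact B)

lemma finite_disjoint_nbrs_permutations:
  assumes "finite V" "simple_graph V B"
  shows "finite {\<sigma>. \<sigma> permutes (disjoint_nbrs B i j \<union> disjoint_nbrs B j i)}"
    and "{\<sigma>. \<sigma> permutes (disjoint_nbrs B i j \<union> disjoint_nbrs B j i)} \<noteq> {}"
proof -
  have "finite (disjoint_nbrs B i j \<union> disjoint_nbrs B j i)"
    using disjoint_nbrs_subset[OF assms(2)] assms(1) by (meson finite_UnI finite_subset)
  then show "finite {\<sigma>. \<sigma> permutes (disjoint_nbrs B i j \<union> disjoint_nbrs B j i)}"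
    by (rule finite_permutations)
  show "{\<sigma>. \<sigma> permutes (disjoint_nbrs B i j \<union> disjoint_nbrs B j i)} \<noteq> {}"
    using permutes_id by blast
qed

lemma set_random_trade:
  assumes "finite V" "simple_graph V B"
  shows "set_pmf (random_trade i j B)
    = {trade i j \<sigma> B | \<sigma>. \<sigma> permutes (disjoint_nbrs B i j \<union> disjoint_nbrs B j i)}"
  using finite_disjoint_nbrs_permutations[OF assms] by (auto simp: random_trade_def)

lemma self_in_random_trade:
  assumes "finite V" "simple_graph V B"
  shows "B \<in> set_pmf (random_trade i j B)"
proof -
  have "trade i j id B = B"
    by (auto simp: trade_def Let_def disjoint_nbrs_def fun_eq_iff)
  then show ?thesis
    unfolding set_random_trade[OF assms] using permutes_id by (metis (mono_tags, lifting) mem_Collect_eq)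
qed

text \<open>Inversion maps the permutations leading from \<open>B\<close> to \<open>C\<close> bijectively to those leading
  back, and both are drawn from the same symmetric group.\<close>

lemma pmf_random_trade_sym:
  assumes V: "finite V" "i \<in> V" "j \<in> V" "i \<noteq> j" and B: "simple_graph V B" and C: "simple_graph V C"
  shows "pmf (random_trade i j B) C = pmf (random_trade i j C) B"
proof -
  define S where "S A = disjoint_nbrs A i j \<union> disjoint_nbrs A j i" for A
  define F where "F A D = {\<sigma>. \<sigma> permutes S A \<and> trade i j \<sigma> A = D}" for A D
  have inv: "S D = S A \<and> inv \<sigma> \<in> F D A" if "simple_graph V A" "\<sigma> \<in> F A D" for A D \<sigma>
    using that disjoint_nbrs_trade_Un[OF that(1) V(4), of \<sigma>] trade_inv[OF V that(1), of \<sigma>]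
      permutes_inv[of \<sigma> "S A"]
    by (auto simp: F_def S_def)
  have fin: "finite (F A D)" if "simple_graph V A" for A D
    using finite_disjoint_nbrs_permutations(1)[OF V(1) that, of i j]
    by (auto simp: F_def S_def intro: finite_subset[rotated])
  have le: "card (F A D) \<le> card (F D A)" if A: "simple_graph V A" and D: "simple_graph V D" for A D
  proof (rule card_inj_on_le[of inv])
    show "inj_on inv (F A D)"
      by (rule inj_onI) (metis (mono_tags, lifting) F_def mem_Collect_eq permutes_inv_inv)
  qed (use inv[OF A] fin[OF D] in auto)
  have pmf: "pmf (random_trade i j A) D = card (F A D) / card {\<sigma>. \<sigma> permutes S A}"
    if "simple_graph V A" for A D
  proof -
    have "pmf (random_trade i j A) D = measure_pmf.prob (pmf_of_set {\<sigma>. \<sigma> permutes S A})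
        ((\<lambda>\<sigma>. trade i j \<sigma> A) -` {D})"
      by (simp add: random_trade_def S_def pmf_map)
    also have "\<dots> = card ({\<sigma>. \<sigma> permutes S A} \<inter> (\<lambda>\<sigma>. trade i j \<sigma> A) -` {D})
        / card {\<sigma>. \<sigma> permutes S A}"
      using finite_disjoint_nbrs_permutations[OF V(1) that, of i j]
      by (subst measure_pmf_of_set) (simp_all add: S_def)
    also have "{\<sigma>. \<sigma> permutes S A} \<inter> (\<lambda>\<sigma>. trade i j \<sigma> A) -` {D} = F A D"
      by (auto simp: F_def)
    finally show ?thesis .
  qed
  have eq: "card (F B C) = card (F C B)"
    using le[OF B C] le[OF C B] by simp
  \<comment> \<open>The denominators of the two probabilities can be compared only if some
    permutation leads from \<open>B\<close> to \<open>C\<close>, which forces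
    \<open>S B = S C\<close>. Otherwise both numerators vanish.\<close>
  show ?thesis
  proof (cases "F B C = {}")
    case True
    with eq show ?thesis by (simp add: pmf[OF B] pmf[OF C])
  next
    case False
    then have "S B = S C" using inv[OF B] by blast
    with eq show ?thesis by (simp add: pmf[OF B] pmf[OF C])
  qed
qed

section \<open>Stationarity of the uniform distribution\<close>

text \<open>By symmetry the column sum at \<open>y\<close> equals the row sum at \<open>y\<close>,
  which is one: the kernel is doubly stochastic on \<open>S\<close>.\<close>

lemma bind_uniform_symmetric_kernel:
  assumes S: "finite S" "S \<noteq> {}"
    and closed: "\<And>x. x \<in> S \<Longrightarrow> set_pmf (K x) \<subseteq> S"
    and sym: "\<And>x y. x \<in> S \<Longrightarrow> y \<in> S \<Longrightarrow> pmf (K x) y = pmf (K y) x"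
  shows "bind_pmf (pmf_of_set S) K = pmf_of_set S"
proof (rule pmf_eqI)
  fix y
  have eq: "pmf (bind_pmf (pmf_of_set S) K) y = (\<Sum>x\<in>S. pmf (K x) y) / card S"
    using S by (subst pmf_bind_finite[OF S(1)]) (auto simp: sum_divide_distrib)
  show "pmf (bind_pmf (pmf_of_set S) K) y = pmf (pmf_of_set S) y"
  proof (cases "y \<in> S")
    case True
    have "(\<Sum>x\<in>S. pmf (K x) y) = (\<Sum>x\<in>S. pmf (K y) x)"
      using sym True by (intro sum.cong) auto
    also have "\<dots> = 1" by (rule sum_pmf_eq_1[OF S(1) closed[OF True]])
    finally show ?thesis using S True by (simp add: eq)
  next
    case False
    then have "(\<Sum>x\<in>S. pmf (K x) y) = 0"
      using closed by (intro sum.neutral) (auto simp: pmf_eq_0_set_pmf)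
    then show ?thesis using S False by (simp add: eq)
  qed
qed

lemma bind_uniform_random_trades:
  assumes "finite V" "simple_graph V G"
    and "\<forall>t\<in>set ts. fst t \<in> V \<and> snd t \<in> V \<and> fst t \<noteq> snd t"
  shows "bind_pmf (pmf_of_set (same_degree_graphs V G)) (random_trades ts)
    = pmf_of_set (same_degree_graphs V G)"
  using assms(3)
proof (induction ts)
  case Nil
  show ?case by (simp add: bind_return_pmf')
next
  case (Cons t ts)
  then have t: "fst t \<in> V" "snd t \<in> V" "fst t \<noteq> snd t" by auto
  have "bind_pmf (pmf_of_set (same_degree_graphs V G)) (random_trade (fst t) (snd t))
      = pmf_of_set (same_degree_graphs V G)"
  proof (rule bind_uniform_symmetric_kernel)
    show "finite (same_degree_graphs V G)" by (rule finite_same_degree_graphs[OF assms(1)])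
    show "same_degree_graphs V G \<noteq> {}" using self_in_same_degree_graphs[OF assms(2)] by blast
    show "set_pmf (random_trade (fst t) (snd t) B) \<subseteq> same_degree_graphs V G"
      if "B \<in> same_degree_graphs V G" for B
      by (rule random_trade_in_same_degree_graphs[OF assms(1) t that])
    show "pmf (random_trade (fst t) (snd t) B) C = pmf (random_trade (fst t) (snd t) C) B"
      if "B \<in> same_degree_graphs V G" "C \<in> same_degree_graphs V G" for B C
      using that pmf_random_trade_sym[OF assms(1) t] by (simp add: same_degree_graphs_def)
  qed
  then show ?case using Cons by (simp flip: bind_assoc_pmf)
qed

lemma global_trade_pairs:
  assumes "inj_on v {1..n}" "\<pi> permutes (v ` {1..n})"
  shows "\<forall>t\<in>set (map (\<lambda>i. (\<pi> (v (2 * i - 1)), \<pi> (v (2 * i)))) [1..<n div 2 + 1]).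
    fst t \<in> v ` {1..n} \<and> snd t \<in> v ` {1..n} \<and> fst t \<noteq> snd t"
proof -
  have "\<pi> (v (2 * i - 1)) \<in> v ` {1..n} \<and> \<pi> (v (2 * i)) \<in> v ` {1..n}
      \<and> \<pi> (v (2 * i - 1)) \<noteq> \<pi> (v (2 * i))"
    if i: "1 \<le> i" "i \<le> n div 2" for i
  proof -
    have r: "2 * i - 1 \<in> {1..n}" "2 * i \<in> {1..n}" using i by auto
    moreover have "v (2 * i - 1) \<noteq> v (2 * i)" using inj_onD[OF assms(1) _ r] i by auto
    ultimately show ?thesis
      using permutes_in_image[OF assms(2)] permutes_inj[OF assms(2)] by (auto dest: injD)
  qed
  then show ?thesis by auto
qed

lemma set_pmf_uniform_permutations:
  "finite V \<Longrightarrow> set_pmf (pmf_of_set {\<pi>. \<pi> permutes V}) = {\<pi>. \<pi> permutes V}"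
  by (rule set_pmf_of_set) (use permutes_id finite_permutations in blast)+

lemma bind_uniform_global_trade:
  assumes v: "inj_on v {1..n}" and G: "simple_graph (v ` {1..n}) G"
  shows "bind_pmf (pmf_of_set (same_degree_graphs (v ` {1..n}) G)) (global_trade n v)
    = pmf_of_set (same_degree_graphs (v ` {1..n}) G)"
proof -
  let ?u = "pmf_of_set (same_degree_graphs (v ` {1..n}) G)"
  let ?P = "pmf_of_set {\<pi>. \<pi> permutes (v ` {1..n})}"
  let ?ts = "\<lambda>\<pi>. map (\<lambda>i. (\<pi> (v (2 * i - 1)), \<pi> (v (2 * i)))) [1..<n div 2 + 1]"
  \<comment> \<open>The pairing \<pi> is drawn independently of the current graph, so the draws can
    be exchanged and stationarity checked for each fixed \<pi>.\<close>
  have "bind_pmf ?u (global_trade n v) = bind_pmf ?P (\<lambda>\<pi>. bind_pmf ?u (random_trades (?ts \<pi>)))"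
    unfolding global_trade_def by (rule bind_commute_pmf)
  also have "\<dots> = bind_pmf ?P (\<lambda>_. ?u)"
  proof (rule bind_pmf_cong[OF refl])
    fix \<pi> assume "\<pi> \<in> set_pmf ?P"
    then have "\<pi> permutes (v ` {1..n})" by (simp add: set_pmf_uniform_permutations)
    then show "bind_pmf ?u (random_trades (?ts \<pi>)) = ?u"
      by (intro bind_uniform_random_trades[OF _ G] global_trade_pairs[OF v]) auto
  qed
  finally show ?thesis by simp
qed

section \<open>A global trade can perform any single trade\<close>

lemma self_in_random_trades:
  assumes "finite V" "simple_graph V B"
  shows "B \<in> set_pmf (random_trades ts B)"
  using self_in_random_trade[OF assms] by (induction ts) auto

lemma self_in_global_trade:
  assumes "simple_graph (v ` {1..n}) B"
  shows "B \<in> set_pmf (global_trade n v B)"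
  using self_in_random_trades[OF _ assms]
  by (auto simp: global_trade_def set_pmf_uniform_permutations intro!: exI[of _ id] permutes_id)

text \<open>Choose \<pi> so that the first pair traded is \<open>(i, j)\<close>; with positive
  probability all later trades act as the identity.\<close>

lemma random_trade_in_global_trade:
  assumes v: "inj_on v {1..n}" and ij: "i \<in> v ` {1..n}" "j \<in> v ` {1..n}" "i \<noteq> j"
    and B: "simple_graph (v ` {1..n}) B" and C: "C \<in> set_pmf (random_trade i j B)"
  shows "C \<in> set_pmf (global_trade n v B)"
proof -
  let ?V = "v ` {1..n}"
  have n: "2 \<le> n"
    using ij by (cases "n = 0 \<or> n = 1") auto
  then have v12: "v 1 \<in> ?V" "v 2 \<in> ?V" "v 1 \<noteq> v 2"
    using inj_onD[OF v, of 1 2] by auto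
  \<comment> \<open>The first transposition sends \<open>v 1\<close> to \<open>i\<close>. The second
    sends the image of \<open>v 2\<close> to \<open>j\<close> and fixes \<open>i\<close>, since
    neither point that it moves is \<open>i\<close>.\<close>
  define \<tau> where "\<tau> = Transposition.transpose (v 1) i"
  define \<pi> where "\<pi> = Transposition.transpose (\<tau> (v 2)) j \<circ> \<tau>"
  have \<tau>: "\<tau> permutes ?V" unfolding \<tau>_def using v12 ij by (intro permutes_swap_id) auto
  have \<pi>: "\<pi> permutes ?V"
    unfolding \<pi>_def using v12 ij permutes_in_image[OF \<tau>]
    by (intro permutes_compose[OF \<tau>] permutes_swap_id) auto
  have "\<tau> (v 2) \<noteq> i" using v12 by (auto simp: \<tau>_def Transposition.transpose_def)
  then have \<pi>12: "\<pi> (v 1) = i" "\<pi> (v 2) = j"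
    using ij by (auto simp: \<pi>_def \<tau>_def Transposition.transpose_def)
  define ts where "ts = map (\<lambda>i. (\<pi> (v (2 * i - 1)), \<pi> (v (2 * i)))) [2..<n div 2 + 1]"
  \<comment> \<open>As \<open>n\<close> is at least 2, there is a first trade, at index 1, between
    the images of \<open>v 1\<close> and \<open>v 2\<close>.\<close>
  have "[1..<n div 2 + 1] = 1 # [2..<n div 2 + 1]"
    using div_le_mono[OF n, of 2] upt_conv_Cons[of 1 "n div 2 + 1"]
    by (simp add: numeral_2_eq_2)
  then have ts: "map (\<lambda>i. (\<pi> (v (2 * i - 1)), \<pi> (v (2 * i)))) [1..<n div 2 + 1] = (i, j) # ts"
    using \<pi>12 by (simp only: ts_def list.map) simp
  have "C \<in> same_degree_graphs ?V B"
    using random_trade_in_same_degree_graphs[OF _ ij self_in_same_degree_graphs[OF B]] C by blast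
  then have "simple_graph ?V C" by (simp add: same_degree_graphs_def)
  then have "C \<in> set_pmf (random_trades ((i, j) # ts) B)"
    using C self_in_random_trades[of ?V C ts] by auto
  then show ?thesis
    using \<pi> unfolding global_trade_def set_bind_pmf ts[symmetric]
    by (auto simp: set_pmf_uniform_permutations)
qed

section \<open>Connectivity under single trades\<close>

text \<open>The classical edge switch as a trade: swapping \<open>v\<close> and \<open>z\<close>
  between the lists of \<open>x\<close> and \<open>y\<close> replaces the edges \<open>vx\<close>,
  \<open>yz\<close> by \<open>vy\<close>, \<open>xz\<close>.\<close>

lemma trade_transpose:
  assumes V: "finite V" and A: "simple_graph V A"
    and x: "v \<in> A x" "z \<notin> A x" "z \<noteq> x" and y: "v \<notin> A y" "z \<in> A y" "v \<noteq> y"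
  obtains C where "C \<in> set_pmf (random_trade x y A)" "simple_graph V C"
    and "C v = insert y (A v - {x})"
    and "\<And>s. s \<notin> {v, x, y, z} \<Longrightarrow> C s = A s"
proof -
  have sub: "\<And>u. A u \<subseteq> V" and irr: "\<And>u. u \<notin> A u" and sym: "\<And>u w. w \<in> A u \<longleftrightarrow> u \<in> A w"
    using A by (auto simp: simple_graph_def)
  define P where "P = disjoint_nbrs A x y"
  define Q where "Q = disjoint_nbrs A y x"
  define \<sigma> where "\<sigma> = Transposition.transpose v z"
  define C where "C = trade x y \<sigma> A"
  have xy: "x \<noteq> y" using x y by auto
  have xV: "x \<in> V" "y \<in> V" using x y sub sym by blast+
  have vx: "v \<noteq> x" "z \<noteq> y" "v \<noteq> z" using x y irr by auto
  have PQ: "v \<in> P" "z \<in> Q" "z \<notin> P" "v \<notin> Q"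
    using x y by (auto simp: P_def Q_def disjoint_nbrs_def)
  have \<sigma>: "\<sigma> permutes (P \<union> Q)"
    unfolding \<sigma>_def using PQ by (intro permutes_swap_id) auto
  have C: "simple_graph V C"
    unfolding C_def using \<sigma> trade_simple_graph[OF V xV xy A] by (simp add: P_def Q_def)
  have symC: "\<And>u w. w \<in> C u \<longleftrightarrow> u \<in> C w" using C by (auto simp: simple_graph_def)
  have "\<sigma> ` P = insert z (P - {v})" "\<sigma> ` Q = insert v (Q - {z})"
    using PQ by (auto simp: \<sigma>_def Transposition.transpose_def image_iff)
  then have Cx: "C x = insert z (A x - {v})" and Cy: "C y = insert v (A y - {z})"
    using PQ unfolding C_def trade_first trade_second[OF xy] P_def Q_def
    by (auto simp: disjoint_nbrs_def)
  have other: "w \<in> C u \<longleftrightarrow> w \<in> A u" if "u \<notin> {x, y}" "w \<notin> {x, y}" for u w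
    using trade_other[of u x y \<sigma> A] that unfolding C_def by blast
  show ?thesis
  proof (rule that)
    show "C \<in> set_pmf (random_trade x y A)"
      using \<sigma> unfolding set_random_trade[OF V A] C_def P_def Q_def by blast
    show "C v = insert y (A v - {x})"
    proof (rule set_eqI)
      fix w
      show "w \<in> C v \<longleftrightarrow> w \<in> insert y (A v - {x})"
        using symC[of w v] sym[of w v] other[of v w] Cx Cy vx y(3) xy by (cases "w = x \<or> w = y") auto
    qed
    show "C s = A s" if "s \<notin> {v, x, y, z}" for s
    proof (rule set_eqI)
      fix w
      show "w \<in> C s \<longleftrightarrow> w \<in> A s"
        using symC[of w s] sym[of w s] other[of s w] Cx Cy that by (cases "w = x \<or> w = y") auto
    qed
  qed (fact C)
qed

text \<open>As in the Havel--Hakimi argument, the degree comparison (within \<open>V - S\<close>, so that the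
  neighbourhoods of the nodes in \<open>S\<close> stay untouched) supplies the fourth node of the switch.\<close>

lemma exchange_neighbour:
  assumes V: "finite V" and A: "simple_graph V A"
    and S: "v \<notin> S" "x \<notin> S" "y \<notin> S"
    and x: "x \<in> A v" and y: "y \<notin> A v" "y \<noteq> v"
    and le: "card (A x - S) \<le> card (A y - S)"
  obtains C where "C \<in> set_pmf (random_trade x y A)"
    and "C v = insert y (A v - {x})" "\<And>s. s \<in> S \<Longrightarrow> C s = A s"
proof -
  have sub: "\<And>u. A u \<subseteq> V" and irr: "\<And>u. u \<notin> A u" and sym: "\<And>u w. w \<in> A u \<longleftrightarrow> u \<in> A w"
    using A by (auto simp: simple_graph_def)
  have fin: "finite (A u)" for u using sub V finite_subset by blast
  \<comment> \<open>An edge between \<open>x\<close> and \<open>y\<close> counts once in each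
    residual degree, so removing it preserves the comparison.\<close>
  have "card (A x - S - {y}) \<le> card (A y - S - {x})"
    using le sym[of x y] S fin by (cases "y \<in> A x") (auto simp: card_Diff_singleton diff_le_mono)
  moreover have "v \<in> A x - S - {y}" "v \<notin> A y - S - {x}"
    using S x y sym by blast+
  \<comment> \<open>An inclusion would be proper because of \<open>v\<close>, contradicting the
    cardinalities. Any witness against it serves as the fourth node \<open>z\<close>.\<close>
  ultimately have "\<not> A y - S - {x} \<subseteq> A x - S - {y}"
    using fin by (metis finite_Diff psubsetI psubset_card_mono linorder_not_less)
  then obtain z where z: "z \<in> A y" "z \<notin> S" "z \<noteq> x" "z \<notin> A x"
    using irr by blast
  obtain C where C: "C \<in> set_pmf (random_trade x y A)" "C v = insert y (A v - {x})"
    and same: "\<And>s. s \<notin> {v, x, y, z} \<Longrightarrow> C s = A s"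
    using trade_transpose[OF V A, of v x z y] x y z sym by metis
  have "C s = A s" if "s \<in> S" for s
    by (rule same) (use S z(2) that in blast)
  with C show ?thesis by (rule that)
qed

definition trade_rel :: "'a set \<Rightarrow> 'a adj \<Rightarrow> ('a adj \<times> 'a adj) set" where
  "trade_rel V G = {(B, C). B \<in> same_degree_graphs V G \<and>
     (\<exists>i\<in>V. \<exists>j\<in>V. i \<noteq> j \<and> C \<in> set_pmf (random_trade i j B))}"

lemma trade_relI:
  assumes "B \<in> same_degree_graphs V G" "i \<in> V" "j \<in> V" "i \<noteq> j" "C \<in> set_pmf (random_trade i j B)"
  shows "(B, C) \<in> trade_rel V G"
  using assms by (auto simp: trade_rel_def)

lemma trade_rel_closed:
  assumes "finite V" "(B, C) \<in> trade_rel V G"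
  shows "C \<in> same_degree_graphs V G"
  using random_trade_in_same_degree_graphs[OF assms(1)] assms(2)
  unfolding trade_rel_def by blast

text \<open>Needed because the connecting path is built from both ends: trades made in the target
  graph are later traversed backwards.\<close>

lemma sym_trade_rel:
  assumes "finite V"
  shows "sym (trade_rel V G)"
proof (rule symI)
  fix B C assume BC: "(B, C) \<in> trade_rel V G"
  then have C: "C \<in> same_degree_graphs V G" by (rule trade_rel_closed[OF assms])
  from BC obtain i j where ij: "i \<in> V" "j \<in> V" "i \<noteq> j" "C \<in> set_pmf (random_trade i j B)"
    and B: "B \<in> same_degree_graphs V G"
    by (auto simp: trade_rel_def)
  have "B \<in> set_pmf (random_trade i j C)"
    using pmf_random_trade_sym[OF assms ij(1-3), of B C] ij(4) B C
    by (simp add: same_degree_graphs_def set_pmf_iff)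
  then show "(C, B) \<in> trade_rel V G" by (rule trade_relI[OF C ij(1-3)])
qed

text \<open>Nested induction: the outer one on the number of nodes outside \<open>S\<close>, the set
  where the lists already agree, and the inner one on how many neighbours of the next node
  \<open>v\<close> in \<open>A\<close> are missing in \<open>B\<close>.\<close>

lemma trade_rel_connected_aux:
  assumes V: "finite V"
  shows "S \<subseteq> V \<Longrightarrow> A \<in> same_degree_graphs V G \<Longrightarrow> B \<in> same_degree_graphs V G \<Longrightarrow>
    (\<And>s. s \<in> S \<Longrightarrow> A s = B s) \<Longrightarrow> (A, B) \<in> (trade_rel V G)\<^sup>*"
proof (induction "card (V - S)" arbitrary: S A B)
  case 0
  then have "S = V" using V by auto
  have "A s = B s" for s
    using 0 \<open>S = V\<close> by (cases "s \<in> V") (auto simp: same_degree_graphs_def simple_graph_def)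
  then have "A = B" by blast
  then show ?case by simp
next
  case (Suc m)
  then obtain v where v: "v \<in> V" "v \<notin> S" by (metis Diff_eq_empty_iff card.empty nat.distinct(1) subsetI)
  have m: "m = card (V - insert v S)"
    using Suc.hyps(2) v card_Diff_singleton[of v "V - S"] by (simp flip: Diff_insert2)
  note outer = Suc.hyps(1)[OF m]
  show ?case using Suc.prems(2-)
  proof (induction "card (A v - B v)" arbitrary: A B)
    case (0 A B)
    have gA: "simple_graph V A" and gB: "simple_graph V B" and deg: "card (A v) = card (B v)"
      using 0 v by (auto simp: same_degree_graphs_def)
    have fin: "finite (A v)" "finite (B v)"
      using gA gB V finite_subset unfolding simple_graph_def by metis+
    then have "A v \<subseteq> B v" using 0 by auto
    then have "A v = B v" using card_subset_eq[OF fin(2) _ deg] by blast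
    then show ?case using 0 v Suc.prems(1) by (intro outer) auto
  next
    case (Suc k A B)
    have gA: "simple_graph V A" and gB: "simple_graph V B"
      and deg: "\<And>u. u \<in> V \<Longrightarrow> card (A u) = card (B u)"
      using Suc.prems by (auto simp: same_degree_graphs_def)
    have subA: "\<And>u. A u \<subseteq> V" and symA: "\<And>u w. w \<in> A u \<longleftrightarrow> u \<in> A w" and irrA: "\<And>u. u \<notin> A u"
      using gA by (auto simp: simple_graph_def)
    have subB: "\<And>u. B u \<subseteq> V" and symB: "\<And>u w. w \<in> B u \<longleftrightarrow> u \<in> B w" and irrB: "\<And>u. u \<notin> B u"
      using gB by (auto simp: simple_graph_def)
    have fin: "finite (A u)" "finite (B u)" for u
      by (rule finite_subset[OF subA V], rule finite_subset[OF subB V])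
    obtain x where x: "x \<in> A v" "x \<notin> B v"
      using Suc.hyps(2) by (metis Diff_iff card.empty equals0I nat.distinct(1))
    then have "\<not> B v \<subseteq> A v"
      using card_subset_eq[OF fin(1)[of v], of "B v"] deg[OF v(1)] by auto
    then obtain y where y: "y \<in> B v" "y \<notin> A v" by blast
    \<comment> \<open>Nodes of \<open>S\<close> have the same lists in both graphs, so by symmetry
      they cannot distinguish \<open>A v\<close> from \<open>B v\<close>.\<close>
    have S: "x \<notin> S" "y \<notin> S"
      using x y Suc.prems(3) symA[of v] symB[of v] by blast+
    have xV: "x \<in> V" "y \<in> V" "x \<noteq> y" and xv: "x \<noteq> v" "y \<noteq> v"
      using x y subA subB irrA irrB by blast+
    \<comment> \<open>Equal residual degrees carry the comparison of \<open>x\<close> and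
      \<open>y\<close> over from \<open>A\<close> to \<open>B\<close>: if it fails for a switch in
      \<open>A\<close>, the reverse one holds for a switch in \<open>B\<close>.\<close>
    have rdeg: "card (A u - S) = card (B u - S)" if "u \<in> V" for u
    proof -
      have "A u \<inter> S = B u \<inter> S"
        using Suc.prems(3) by (auto simp: symA[of _ u] symB[of _ u])
      then show ?thesis
        using deg[OF that] fin by (simp add: card_Diff_subset_Int)
    qed
    show ?case
    proof (cases "card (A x - S) \<le> card (A y - S)")
      case True
      obtain C where C: "C \<in> set_pmf (random_trade x y A)"
        "C v = insert y (A v - {x})" "\<And>s. s \<in> S \<Longrightarrow> C s = A s"
        using exchange_neighbour[OF V gA v(2) S x(1) y(2) xv(2) True] by blast
      have AC: "(A, C) \<in> trade_rel V G"
        by (rule trade_relI[OF Suc.prems(1) xV(1,2,3) C(1)])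
      \<comment> \<open>The switch removes \<open>x\<close> from the difference, and the new
        neighbour \<open>y\<close> already lies in \<open>B v\<close>.\<close>
      have "C v - B v = (A v - B v) - {x}" unfolding C(2) using y by blast
      then have "k = card (C v - B v)"
        using Suc.hyps(2) x fin by (simp add: card_Diff_singleton)
      then have "(C, B) \<in> (trade_rel V G)\<^sup>*"
        using Suc.hyps(1) trade_rel_closed[OF V AC] Suc.prems C(3) by auto
      with AC show ?thesis by (rule converse_rtrancl_into_rtrancl)
    next
      case False
      then have "card (B y - S) \<le> card (B x - S)" using rdeg xV by simp
      then obtain C where C: "C \<in> set_pmf (random_trade y x B)"
        "C v = insert x (B v - {y})" "\<And>s. s \<in> S \<Longrightarrow> C s = B s"
        using exchange_neighbour[OF V gB v(2) S(2,1) y(1) x(2) xv(1)] by blast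
      have BC: "(B, C) \<in> trade_rel V G"
        by (rule trade_relI[OF Suc.prems(2) xV(2,1) xV(3)[symmetric] C(1)])
      \<comment> \<open>Here the target moves instead: \<open>B\<close> gains \<open>x\<close> at
        \<open>v\<close> and loses \<open>y\<close>, which is not in \<open>A v\<close>.\<close>
      have "A v - C v = (A v - B v) - {x}" unfolding C(2) using y by blast
      then have "k = card (A v - C v)"
        using Suc.hyps(2) x fin by (simp add: card_Diff_singleton)
      then have "(A, C) \<in> (trade_rel V G)\<^sup>*"
        using Suc.hyps(1) trade_rel_closed[OF V BC] Suc.prems C(3) by auto
      then show ?thesis
        using symD[OF sym_trade_rel[OF V] BC] by (rule rtrancl_into_rtrancl)
    qed
  qed
qed

lemma trade_rel_connected:
  assumes "finite V" "A \<in> same_degree_graphs V G" "B \<in> same_degree_graphs V G"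
  shows "(A, B) \<in> (trade_rel V G)\<^sup>*"
  using trade_rel_connected_aux[OF assms(1), of "{}"] assms(2,3) by blast

theorem theorem1:
  fixes n :: nat and v :: "nat \<Rightarrow> 'a" and V :: "'a set" and G :: "'a adj"
  assumes "inj_on v {1..n}" and "V = v ` {1..n}"
    and "simple_graph V G"
  shows "\<forall>H. (\<lambda>t. pmf (chain_law (global_trade n v) G t) H)
           \<longlonglongrightarrow> pmf (pmf_of_set (same_degree_graphs V G)) H"
proof
  fix H
  let ?S = "same_degree_graphs V G"
  let ?R = "{(B, C). B \<in> ?S \<and> C \<in> set_pmf (global_trade n v B)}"
  have V: "finite V" using assms(2) by simp
  have S: "finite ?S" by (rule finite_same_degree_graphs[OF V])
  have G: "G \<in> ?S" by (rule self_in_same_degree_graphs[OF assms(3)])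
  have graph: "simple_graph V B" if "B \<in> ?S" for B
    using that by (simp add: same_degree_graphs_def)
  \<comment> \<open>Connectivity under single trades thereby passes to the global chain.\<close>
  have "trade_rel V G \<subseteq> ?R"
    using random_trade_in_global_trade[OF assms(1), folded assms(2)] graph
    unfolding trade_rel_def by blast
  then have irred: "(B, C) \<in> ?R\<^sup>*" if "B \<in> ?S" "C \<in> ?S" for B C
    using rtrancl_mono trade_rel_connected[OF V that] by blast
  show "(\<lambda>t. pmf (chain_law (global_trade n v) G t) H) \<longlonglongrightarrow> pmf (pmf_of_set ?S) H"
  proof (rule chain_law_converges[OF S _ _ irred _ _ G])
    show "set_pmf (global_trade n v B) \<subseteq> ?S" if "B \<in> ?S" for B
      using global_trade_in_same_degree_graphs[OF assms(1)] that assms(2) by blast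
    show "B \<in> set_pmf (global_trade n v B)" if "B \<in> ?S" for B
      using self_in_global_trade graph[OF that] assms(2) by blast
    show "set_pmf (pmf_of_set ?S) \<subseteq> ?S"
      using S G by (subst set_pmf_of_set) auto
    show "bind_pmf (pmf_of_set ?S) (global_trade n v) = pmf_of_set ?S"
      using bind_uniform_global_trade[OF assms(1)] assms(2,3) by simp
  qed
qed

end
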